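(* For every locale $L$ the following implications hold: if $L$ is a complete Boolean algebra then $L$ is IDM; if $L$ is IDM then $L$ is IED; if $L$ is IED then $L$ is extremally disconnected. None of these three implications can be reversed: there exists an IDM locale which is not Boolean, there exists an IED locale which is not IDM, and there exists an extremally disconnected locale which is not IED.
   Context: A locale (= frame) is a complete lattice $L$ with $a\wedge\bigvee B=\bigvee\{a\wedge b\mid b\in B\}$ for all $a\in L$, $B\subseteq L$. It is a complete Heyting algebra with Heyting operation $\to$; the pseudocomplement of $a$ is $a^*=a\to 0$, and $a^{**}=(a^* )^*$. $L$ is extremally disconnected if $(a\wedge b)^*=a^*\vee b^*$ for all $a,b\in L$. $L$ is IDM (infinitely De Morgan) if $(\bigwedge_{i\in I} a_i)^*\le\bigvee_{i\in I} a_i^*$ for every family $\{a_i\}_{i\in I}\subseteq L$ (arbitrary index set). $L$ is IED (infinitely extremally disconnected) if $(\bigvee_{i\in I} a_i)^{**}\le\bigvee_{i\in I} a_i^{**}$ for every family $\{a_i\}_{i\in I}\subseteq L$ (arbitrary index set). *)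

theory Defs
  imports "HOL-Algebra.Complete_Lattice"
begin

locale frame = complete_lattice L for L (structure) +
  assumes meet_sup_distrib:
    "\<lbrakk>a \<in> carrier L; B \<subseteq> carrier L\<rbrakk> \<Longrightarrow> a \<sqinter> (\<Squnion> B) = \<Squnion> ((\<lambda>b. a \<sqinter> b) ` B)"

definition heyting_imp :: "('a, 'm) gorder_scheme \<Rightarrow> 'a \<Rightarrow> 'a \<Rightarrow> 'a" where
  "heyting_imp L a b = \<Squnion>\<^bsub>L\<^esub> {c \<in> carrier L. c \<sqinter>\<^bsub>L\<^esub> a \<sqsubseteq>\<^bsub>L\<^esub> b}"

definition pseudocompl :: "('a, 'm) gorder_scheme \<Rightarrow> 'a \<Rightarrow> 'a" where
  "pseudocompl L a = heyting_imp L a \<bottom>\<^bsub>L\<^esub>"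

definition complete_boolean_algebra :: "('a, 'm) gorder_scheme \<Rightarrow> bool" where
  "complete_boolean_algebra L \<longleftrightarrow>
     complete_lattice L \<and>
     (\<forall>a\<in>carrier L. \<forall>b\<in>carrier L. \<forall>c\<in>carrier L.
        a \<sqinter>\<^bsub>L\<^esub> (b \<squnion>\<^bsub>L\<^esub> c) = (a \<sqinter>\<^bsub>L\<^esub> b) \<squnion>\<^bsub>L\<^esub> (a \<sqinter>\<^bsub>L\<^esub> c)) \<and>
     (\<forall>a\<in>carrier L. \<exists>b\<in>carrier L. a \<sqinter>\<^bsub>L\<^esub> b = \<bottom>\<^bsub>L\<^esub> \<and> a \<squnion>\<^bsub>L\<^esub> b = \<top>\<^bsub>L\<^esub>)"

definition extremally_disconnected :: "('a, 'm) gorder_scheme \<Rightarrow> bool" where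
  "extremally_disconnected L \<longleftrightarrow>
     (\<forall>a\<in>carrier L. \<forall>b\<in>carrier L.
        pseudocompl L (a \<sqinter>\<^bsub>L\<^esub> b) = pseudocompl L a \<squnion>\<^bsub>L\<^esub> pseudocompl L b)"

(* A definition cannot quantify over index types, so a family is represented by its set of
   values; the lemmas IDM_family and IED_family below recover families over any index type. *)

definition IDM :: "('a, 'm) gorder_scheme \<Rightarrow> bool" where
  "IDM L \<longleftrightarrow>
     (\<forall>A. A \<subseteq> carrier L \<longrightarrow>
        pseudocompl L (\<Sqinter>\<^bsub>L\<^esub> A) \<sqsubseteq>\<^bsub>L\<^esub> \<Squnion>\<^bsub>L\<^esub> (pseudocompl L ` A))"

definition IED :: "('a, 'm) gorder_scheme \<Rightarrow> bool" where
  "IED L \<longleftrightarrow>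
     (\<forall>A. A \<subseteq> carrier L \<longrightarrow>
        pseudocompl L (pseudocompl L (\<Squnion>\<^bsub>L\<^esub> A))
          \<sqsubseteq>\<^bsub>L\<^esub> \<Squnion>\<^bsub>L\<^esub> ((\<lambda>a. pseudocompl L (pseudocompl L a)) ` A))"

lemma IDM_family:
  assumes "IDM L" and "\<And>i. i \<in> I \<Longrightarrow> a i \<in> carrier L"
  shows "pseudocompl L (\<Sqinter>\<^bsub>L\<^esub> (a ` I)) \<sqsubseteq>\<^bsub>L\<^esub> \<Squnion>\<^bsub>L\<^esub> ((\<lambda>i. pseudocompl L (a i)) ` I)"
proof -
  have "a ` I \<subseteq> carrier L" using assms(2) by auto
  with assms(1) show ?thesis unfolding IDM_def by (metis image_image)
qed

lemma IED_family:
  assumes "IED L" and "\<And>i. i \<in> I \<Longrightarrow> a i \<in> carrier L"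
  shows "pseudocompl L (pseudocompl L (\<Squnion>\<^bsub>L\<^esub> (a ` I)))
           \<sqsubseteq>\<^bsub>L\<^esub> \<Squnion>\<^bsub>L\<^esub> ((\<lambda>i. pseudocompl L (pseudocompl L (a i))) ` I)"
proof -
  have "a ` I \<subseteq> carrier L" using assms(2) by auto
  then have "pseudocompl L (pseudocompl L (\<Squnion>\<^bsub>L\<^esub> (a ` I)))
      \<sqsubseteq>\<^bsub>L\<^esub> \<Squnion>\<^bsub>L\<^esub> ((\<lambda>x. pseudocompl L (pseudocompl L x)) ` (a ` I))"
    using assms(1) unfolding IED_def by blast
  then show ?thesis by (simp only: image_image)
qed

lemma (in frame) heyting_adjunction:
  assumes a: "a \<in> carrier L" and b: "b \<in> carrier L" and c: "c \<in> carrier L"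
  shows "c \<sqsubseteq> heyting_imp L a b \<longleftrightarrow> c \<sqinter> a \<sqsubseteq> b"
proof
  let ?S = "{c \<in> carrier L. c \<sqinter> a \<sqsubseteq> b}"
  have S: "?S \<subseteq> carrier L" by auto
  have h: "heyting_imp L a b \<in> carrier L"
    unfolding heyting_imp_def by (rule sup_closed[OF S])
  show "c \<sqsubseteq> heyting_imp L a b" if "c \<sqinter> a \<sqsubseteq> b"
    unfolding heyting_imp_def using that c by (intro sup_upper[OF S]) auto
  assume le: "c \<sqsubseteq> heyting_imp L a b"
  have "c \<sqinter> a \<sqsubseteq> a \<sqinter> heyting_imp L a b"
  proof (rule meet_le)
    show "c \<sqinter> a \<sqsubseteq> a" using a c by (simp add: meet_right)
    show "c \<sqinter> a \<sqsubseteq> heyting_imp L a b"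
      using le_trans[OF meet_left[OF c a] le] a c h by simp
  qed (use a c h in auto)
  also have "a \<sqinter> heyting_imp L a b = \<Squnion> ((\<lambda>d. a \<sqinter> d) ` ?S)"
    unfolding heyting_imp_def by (rule meet_sup_distrib[OF a S])
  finally have 1: "c \<sqinter> a \<sqsubseteq> \<Squnion> ((\<lambda>d. a \<sqinter> d) ` ?S)" .
  have I: "(\<lambda>d. a \<sqinter> d) ` ?S \<subseteq> carrier L" using a by auto
  have "\<Squnion> ((\<lambda>d. a \<sqinter> d) ` ?S) \<sqsubseteq> b"
  proof (rule sup_least[OF I b])
    fix x assume "x \<in> (\<lambda>d. a \<sqinter> d) ` ?S"
    then obtain d where "d \<in> carrier L" "d \<sqinter> a \<sqsubseteq> b" "x = a \<sqinter> d" by auto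
    then show "x \<sqsubseteq> b" by (simp add: meet_comm)
  qed
  with 1 show "c \<sqinter> a \<sqsubseteq> b"
    using a b c I by (meson le_trans meet_closed sup_closed)
qed

end

(* Every frame of open sets of an irreducible space is IED, since there a nonempty open set has
   pseudocomplement the empty set. The particular point topology has a least nonempty open set,
   which makes its frame IDM, but that set has no complement. In the cofinite topology the
   complements of points have empty intersection while all their pseudocomplements are empty, so
   its frame is not IDM.

   For the last separation take the ideals of the power set of the naturals (the open sets of the
   Stone-Cech compactification). The pseudocomplement of an ideal I is the principal ideal of the
   complement of the union of I, which yields the De Morgan law. The ideals of subsets of {n} are
   regular, and their join is the ideal of finite sets, whose double pseudocomplement is
   everything. *)

theory Submission
  imports Defs
begin

section \<open>Implications in an arbitrary frame\<close>

context frame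
begin

section \<open>Calculus of pseudocomplements\<close>

lemma pseudocompl_closed [simp]: "pseudocompl L a \<in> carrier L"
  unfolding pseudocompl_def heyting_imp_def by (rule sup_closed) auto

lemma le_bottom_iff: "x \<in> carrier L \<Longrightarrow> x \<sqsubseteq> \<bottom> \<longleftrightarrow> x = \<bottom>"
  by (auto intro: le_antisym)

lemma le_pseudocompl_iff:
  assumes "a \<in> carrier L" "c \<in> carrier L"
  shows "c \<sqsubseteq> pseudocompl L a \<longleftrightarrow> c \<sqinter> a = \<bottom>"
  unfolding pseudocompl_def using assms by (simp add: heyting_adjunction le_bottom_iff)

text \<open>Both sides say that \<open>a\<close> and \<open>c\<close> are disjoint. So
  \<open>pseudocompl L\<close> forms an antitone Galois connection with itself, which yields
  antitonicity, the triple law and the De Morgan law for joins.\<close>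

lemma pseudocompl_swap:
  assumes "a \<in> carrier L" "c \<in> carrier L"
  shows "c \<sqsubseteq> pseudocompl L a \<longleftrightarrow> a \<sqsubseteq> pseudocompl L c"
  using assms by (simp add: le_pseudocompl_iff meet_comm)

lemma le_double_pseudocompl:
  assumes "a \<in> carrier L"
  shows "a \<sqsubseteq> pseudocompl L (pseudocompl L a)"
  using assms pseudocompl_swap[of "pseudocompl L a" a] by simp

lemma pseudocompl_antimono:
  assumes "a \<sqsubseteq> b" "a \<in> carrier L" "b \<in> carrier L"
  shows "pseudocompl L b \<sqsubseteq> pseudocompl L a"
proof -
  have "a \<sqsubseteq> pseudocompl L (pseudocompl L b)"
    using le_trans[OF assms(1) le_double_pseudocompl] assms by simp
  then show ?thesis using assms pseudocompl_swap[of a "pseudocompl L b"] by simp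
qed

lemma triple_pseudocompl:
  assumes "a \<in> carrier L"
  shows "pseudocompl L (pseudocompl L (pseudocompl L a)) = pseudocompl L a"
  by (rule le_antisym) (use assms in \<open>auto intro!: pseudocompl_antimono le_double_pseudocompl\<close>)

lemma pseudocompl_sup:
  assumes A: "A \<subseteq> carrier L"
  shows "pseudocompl L (\<Squnion> A) = \<Sqinter> (pseudocompl L ` A)"
proof (rule le_antisym)
  have pA: "pseudocompl L ` A \<subseteq> carrier L" by auto
  show "pseudocompl L (\<Squnion> A) \<sqsubseteq> \<Sqinter> (pseudocompl L ` A)"
    by (rule inf_greatest[OF pA]) (use A in \<open>auto intro!: pseudocompl_antimono sup_upper\<close>)
  have "\<Squnion> A \<sqsubseteq> pseudocompl L (\<Sqinter> (pseudocompl L ` A))"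
  proof (rule sup_least[OF A])
    fix x assume x: "x \<in> A"
    then have "\<Sqinter> (pseudocompl L ` A) \<sqsubseteq> pseudocompl L x" using pA by (intro inf_lower) auto
    then show "x \<sqsubseteq> pseudocompl L (\<Sqinter> (pseudocompl L ` A))"
      using pseudocompl_swap[of x "\<Sqinter> (pseudocompl L ` A)"] x A pA by auto
  qed simp
  then show "\<Sqinter> (pseudocompl L ` A) \<sqsubseteq> pseudocompl L (\<Squnion> A)"
    using pseudocompl_swap[of "\<Squnion> A" "\<Sqinter> (pseudocompl L ` A)"] A pA by simp
  show "\<Sqinter> (pseudocompl L ` A) \<in> carrier L" using pA by simp
qed simp

lemma pseudocompl_join:
  assumes "a \<in> carrier L" "b \<in> carrier L"
  shows "pseudocompl L (a \<squnion> b) = pseudocompl L a \<sqinter> pseudocompl L b"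
  using pseudocompl_sup[of "{a, b}"] assms by (simp add: join_def meet_def)

text \<open>Both sides say that \<open>a\<close>, \<open>b\<close> and \<open>c\<close> have meet
  \<bottom>. The right-hand form isolates the pseudocomplement of \<open>b\<close>, so that the
  triple law can be applied to it.\<close>

lemma le_pseudocompl_meet_iff:
  assumes "a \<in> carrier L" "b \<in> carrier L" "c \<in> carrier L"
  shows "c \<sqsubseteq> pseudocompl L (a \<sqinter> b) \<longleftrightarrow> c \<sqinter> a \<sqsubseteq> pseudocompl L b"
  using assms by (simp add: le_pseudocompl_iff meet_assoc)

text \<open>By \<open>le_pseudocompl_meet_iff\<close> the elements below either side depend on the
  second factor only through its pseudocomplement, and \<open>b\<close> shares that with its double
  pseudocomplement. Elements with the same lower bounds are equal.\<close>

lemma pseudocompl_meet_double_right: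
  assumes a: "a \<in> carrier L" and b: "b \<in> carrier L"
  shows "pseudocompl L (a \<sqinter> pseudocompl L (pseudocompl L b)) = pseudocompl L (a \<sqinter> b)"
proof -
  have *: "c \<sqsubseteq> pseudocompl L (a \<sqinter> pseudocompl L (pseudocompl L b)) \<longleftrightarrow> c \<sqsubseteq> pseudocompl L (a \<sqinter> b)"
    if "c \<in> carrier L" for c
    using that a b by (simp add: le_pseudocompl_meet_iff triple_pseudocompl)
  show ?thesis
    using *[of "pseudocompl L (a \<sqinter> b)"]
      *[of "pseudocompl L (a \<sqinter> pseudocompl L (pseudocompl L b))"]
    by (intro le_antisym) auto
qed

lemma pseudocompl_meet_double:
  assumes "a \<in> carrier L" "b \<in> carrier L"
  shows "pseudocompl L (pseudocompl L (pseudocompl L a) \<sqinter> pseudocompl L (pseudocompl L b))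
       = pseudocompl L (a \<sqinter> b)"
  using assms by (simp add: pseudocompl_meet_double_right meet_comm[of L "pseudocompl L _" b]
      meet_comm[of L b a])

section \<open>The three implications\<close>

lemma complete_boolean_algebra_imp_IDM:
  assumes "complete_boolean_algebra L"
  shows "IDM L"
  unfolding IDM_def
proof (intro allI impI)
  fix A assume A: "A \<subseteq> carrier L"
  have dist: "x \<sqinter> (y \<squnion> z) = (x \<sqinter> y) \<squnion> (x \<sqinter> z)"
    if "x \<in> carrier L" "y \<in> carrier L" "z \<in> carrier L" for x y z
    using assms that unfolding complete_boolean_algebra_def by blast
  have compl: "\<exists>y\<in>carrier L. x \<sqinter> y = \<bottom> \<and> x \<squnion> y = \<top>" if "x \<in> carrier L" for x
    using assms that unfolding complete_boolean_algebra_def by blast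
  \<comment> \<open>Distributing \<open>x\<close> over \<open>z \<squnion> y = \<top>\<close> loses
    the part below \<open>y\<close>, so \<open>x = x \<sqinter> z\<close>.\<close>
  have le_if: "x \<sqsubseteq> z" if "x \<sqinter> y = \<bottom>" "z \<squnion> y = \<top>"
    "x \<in> carrier L" "y \<in> carrier L" "z \<in> carrier L" for x y z
  proof -
    have "x = x \<sqinter> (z \<squnion> y)"
      using that le_iff_join top_higher by simp
    also have "\<dots> = (x \<sqinter> z) \<squnion> \<bottom>" using that(1,3-5) dist[of x z y] by simp
    also have "\<dots> = x \<sqinter> z"
      using that bottom_join[of "x \<sqinter> z"] by (simp add: join_comm eq_is_equal)
    finally show ?thesis using that le_iff_join by simp
  qed
  \<comment> \<open>A complement \<open>t\<close> of the join \<open>s\<close> is disjoint from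
    every pseudocomplement of a member of \<open>A\<close>, hence from every complement of a member.
    So \<open>t\<close> lies below each member and below \<Sqinter>\<open>A\<close>, whose
    pseudocomplement is therefore disjoint from \<open>t\<close> and lies below
    \<open>s\<close>.\<close>
  define s where "s = \<Squnion> (pseudocompl L ` A)"
  have pA: "pseudocompl L ` A \<subseteq> carrier L" by auto
  have s: "s \<in> carrier L" unfolding s_def using pA by simp
  obtain t where t: "t \<in> carrier L" "s \<sqinter> t = \<bottom>" "s \<squnion> t = \<top>" using compl[OF s] by blast
  have "t \<sqsubseteq> \<Sqinter> A"
  proof (rule inf_greatest[OF A t(1)])
    fix a assume "a \<in> A"
    then have a: "a \<in> carrier L" using A by auto
    obtain b where b: "b \<in> carrier L" "a \<sqinter> b = \<bottom>" "a \<squnion> b = \<top>" using compl[OF a] by blast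
    have "b \<sqsubseteq> pseudocompl L a" using a b by (simp add: le_pseudocompl_iff meet_comm)
    also have "pseudocompl L a \<sqsubseteq> s" unfolding s_def using pA \<open>a \<in> A\<close> by (intro sup_upper) auto
    also have "s \<sqsubseteq> pseudocompl L t" using s t by (simp add: le_pseudocompl_iff)
    finally have "t \<sqinter> b = \<bottom>" using s t b by (simp add: le_pseudocompl_iff meet_comm)
    then show "t \<sqsubseteq> a" using le_if a b t by blast
  qed
  then have "pseudocompl L (\<Sqinter> A) \<sqsubseteq> pseudocompl L t"
    using t A by (intro pseudocompl_antimono) auto
  then have "pseudocompl L (\<Sqinter> A) \<sqinter> t = \<bottom>" using t le_pseudocompl_iff by simp
  then show "pseudocompl L (\<Sqinter> A) \<sqsubseteq> \<Squnion> (pseudocompl L ` A)"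
    using le_if t s unfolding s_def by simp
qed

text \<open>By \<open>pseudocompl_sup\<close> the double pseudocomplement of a join is the
  pseudocomplement of a meet of pseudocomplements, so IED for \<open>A\<close> is IDM for the set of
  pseudocomplements of members of \<open>A\<close>.\<close>

lemma IDM_imp_IED:
  assumes "IDM L"
  shows "IED L"
  unfolding IED_def
proof (intro allI impI)
  fix A assume "A \<subseteq> carrier L"
  moreover have "pseudocompl L ` A \<subseteq> carrier L" by auto
  ultimately show "pseudocompl L (pseudocompl L (\<Squnion> A))
      \<sqsubseteq> \<Squnion> ((\<lambda>a. pseudocompl L (pseudocompl L a)) ` A)"
    using assms unfolding IDM_def by (metis pseudocompl_sup image_image)
qed

text \<open>IED is applied to the two pseudocomplements of \<open>a\<close> and \<open>b\<close>.
  The double pseudocomplement of their join is the pseudocomplement of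
  \<open>a \<sqinter> b\<close>, and by the triple law each of them equals its own double
  pseudocomplement.\<close>

lemma IED_imp_extremally_disconnected:
  assumes "IED L"
  shows "extremally_disconnected L"
  unfolding extremally_disconnected_def
proof (intro ballI)
  fix a b assume ab: "a \<in> carrier L" "b \<in> carrier L"
  have "pseudocompl L (a \<sqinter> b) = pseudocompl L (pseudocompl L (pseudocompl L a \<squnion> pseudocompl L b))"
    using ab by (simp add: pseudocompl_join pseudocompl_meet_double)
  also have "\<dots> \<sqsubseteq> \<Squnion> ((\<lambda>a. pseudocompl L (pseudocompl L a)) ` {pseudocompl L a, pseudocompl L b})"
    using assms unfolding IED_def join_def
    by (metis empty_subsetI insert_subset pseudocompl_closed)
  also have "\<dots> = pseudocompl L a \<squnion> pseudocompl L b"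
    using ab by (simp add: triple_pseudocompl join_def)
  finally have 1: "pseudocompl L (a \<sqinter> b) \<sqsubseteq> pseudocompl L a \<squnion> pseudocompl L b" by simp
  have 2: "pseudocompl L a \<squnion> pseudocompl L b \<sqsubseteq> pseudocompl L (a \<sqinter> b)"
    using ab by (intro join_le pseudocompl_antimono meet_left meet_right) auto
  show "pseudocompl L (a \<sqinter> b) = pseudocompl L a \<squnion> pseudocompl L b"
    by (rule le_antisym[OF 1 2]) auto
qed

end


section \<open>Frames of sets ordered by inclusion\<close>

abbreviation inclusion_order :: "'b set set \<Rightarrow> 'b set gorder" where
  "inclusion_order K \<equiv> \<lparr>carrier = K, eq = (=), le = (\<subseteq>)\<rparr>"

text \<open>Joins are given by an operation \<open>J\<close> because a join of ideals is in general
  larger than their union; for topologies \<open>J\<close> is the union. \<open>Int_J\<close> is the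
  nontrivial half of frame distributivity.\<close>

locale set_frame =
  fixes K :: "'b set set" and J :: "'b set set \<Rightarrow> 'b set"
  assumes J_closed: "S \<subseteq> K \<Longrightarrow> J S \<in> K"
    and J_upper: "S \<subseteq> K \<Longrightarrow> a \<in> S \<Longrightarrow> a \<subseteq> J S"
    and J_least: "S \<subseteq> K \<Longrightarrow> b \<in> K \<Longrightarrow> (\<And>a. a \<in> S \<Longrightarrow> a \<subseteq> b) \<Longrightarrow> J S \<subseteq> b"
    and Int_closed: "a \<in> K \<Longrightarrow> b \<in> K \<Longrightarrow> a \<inter> b \<in> K"
    and Int_J: "a \<in> K \<Longrightarrow> S \<subseteq> K \<Longrightarrow> a \<inter> J S \<subseteq> J ((\<lambda>b. a \<inter> b) ` S)"
begin

abbreviation "L \<equiv> inclusion_order K"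

lemma partial_order_L: "partial_order L"
  by unfold_locales auto

lemma least_J:
  assumes "S \<subseteq> K"
  shows "least L (J S) (Upper L S)"
proof -
  have "J S \<subseteq> b" if "b \<in> Upper L S" for b
    using that assms by (intro J_least) (auto simp: Upper_def)
  then show ?thesis
    using assms J_closed J_upper unfolding least_def by (auto simp: Upper_def)
qed

lemma complete_lattice_L: "complete_lattice L"
proof -
  interpret partial_order L by (rule partial_order_L)
  show ?thesis
  proof unfold_locales
    fix A assume A: "A \<subseteq> carrier L"
    show "\<exists>s. least L s (Upper L A)" using least_J A by auto
    \<comment> \<open>Infima are joins of all lower bounds; an infinite infimum may be smaller than
      the intersection.\<close>
    have LA: "Lower L A \<subseteq> K" by (auto simp: Lower_def)
    have "J (Lower L A) \<subseteq> x" if "x \<in> A" for x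
      by (rule J_least[OF LA]) (use that A in \<open>auto simp: Lower_def\<close>)
    then have "J (Lower L A) \<in> Lower L A"
      using J_closed[OF LA] by (auto simp: Lower_def)
    then have "greatest L (J (Lower L A)) (Lower L A)"
      using LA J_upper[OF LA] unfolding greatest_def by simp
    then show "\<exists>i. greatest L i (Lower L A)" by blast
  qed
qed

sublocale lat: complete_lattice L by (rule complete_lattice_L)

lemma sup_eq: "S \<subseteq> K \<Longrightarrow> \<Squnion>\<^bsub>L\<^esub> S = J S"
  using lat.least_unique[OF lat.sup_lub least_J] by simp

lemma meet_eq:
  assumes "a \<in> K" "b \<in> K"
  shows "a \<sqinter>\<^bsub>L\<^esub> b = a \<inter> b"
  using lat.meet_left[of a b] lat.meet_right[of a b] lat.meet_le[of "a \<inter> b" a b]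
    assms Int_closed by auto

lemma bottom_eq: "\<bottom>\<^bsub>L\<^esub> = J {}"
  using lat.weak_sup_empty sup_eq[of "{}"] by simp

lemma frame_L: "frame L"
proof unfold_locales
  fix a B assume a: "a \<in> carrier L" and B: "B \<subseteq> carrier L"
  have I: "(\<lambda>b. a \<sqinter>\<^bsub>L\<^esub> b) ` B = (\<lambda>b. a \<inter> b) ` B"
    using a B meet_eq by (intro image_cong) auto
  have IK: "(\<lambda>b. a \<inter> b) ` B \<subseteq> K" using a B Int_closed by auto
  have "J ((\<lambda>b. a \<inter> b) ` B) \<subseteq> a \<inter> J B"
    by (rule J_least[OF IK]) (use a B J_upper[of B] J_closed Int_closed in auto)
  then show "a \<sqinter>\<^bsub>L\<^esub> (\<Squnion>\<^bsub>L\<^esub> B) = \<Squnion>\<^bsub>L\<^esub> ((\<lambda>b. a \<sqinter>\<^bsub>L\<^esub> b) ` B)"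
    using a B Int_J[of a B] IK by (simp add: I sup_eq meet_eq J_closed subset_antisym)
qed

sublocale frame L by (rule frame_L)

text \<open>\<open>J {}\<close> is the bottom element, which for ideals is \<open>{{}}\<close> and
  not the empty set. The third hypothesis makes \<open>p\<close> the greatest element disjoint from
  \<open>a\<close>.\<close>

lemma pseudocompl_eqI:
  assumes "a \<in> K" "p \<in> K" "\<And>c. c \<in> K \<Longrightarrow> c \<subseteq> p \<longleftrightarrow> c \<inter> a = J {}"
  shows "pseudocompl L a = p"
proof -
  have "c \<subseteq> pseudocompl L a \<longleftrightarrow> c \<subseteq> p" if "c \<in> K" for c
    using le_pseudocompl_iff[of a c] that assms by (simp add: meet_eq bottom_eq)
  then show ?thesis using assms(2) pseudocompl_closed[of a] by auto
qed

end


section \<open>Irreducible spaces\<close>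

locale irreducible_space =
  fixes K :: "'b set set"
  assumes Union_open: "S \<subseteq> K \<Longrightarrow> \<Union>S \<in> K"
    and Int_open: "a \<in> K \<Longrightarrow> b \<in> K \<Longrightarrow> a \<inter> b \<in> K"
    and UNIV_open: "UNIV \<in> K"
    and irreducible: "a \<in> K \<Longrightarrow> b \<in> K \<Longrightarrow> a \<noteq> {} \<Longrightarrow> b \<noteq> {} \<Longrightarrow> a \<inter> b \<noteq> {}"
begin

sublocale set_frame K Union
  by unfold_locales (use Union_open Int_open in \<open>blast+\<close>)

lemma empty_open: "{} \<in> K"
  using Union_open[of "{}"] by simp

lemma pseudocompl_empty: "pseudocompl L {} = UNIV"
  using empty_open UNIV_open by (intro pseudocompl_eqI) auto

lemma pseudocompl_nonempty: "a \<in> K \<Longrightarrow> a \<noteq> {} \<Longrightarrow> pseudocompl L a = {}"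
  using empty_open irreducible by (intro pseudocompl_eqI) auto

lemma double_pseudocompl_nonempty:
  "a \<in> K \<Longrightarrow> a \<noteq> {} \<Longrightarrow> pseudocompl L (pseudocompl L a) = UNIV"
  by (simp add: pseudocompl_nonempty pseudocompl_empty)

text \<open>Double pseudocomplements take only the values \<open>{}\<close> and \<open>UNIV\<close>,
  and a union is nonempty only if some member is; that member already contributes
  \<open>UNIV\<close> on the right.\<close>

lemma IED_L: "IED L"
  unfolding IED_def
proof (intro allI impI)
  fix A assume A: "A \<subseteq> carrier L"
  let ?pp = "\<lambda>a. pseudocompl L (pseudocompl L a)"
  have ppA: "?pp ` A \<subseteq> K" using pseudocompl_closed by auto
  have "?pp (\<Union>A) \<subseteq> \<Union>(?pp ` A)"
  proof (cases "\<Union>A = {}")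
    case True
    show ?thesis
      unfolding True by (simp add: pseudocompl_empty pseudocompl_nonempty UNIV_open)
  next
    case False
    then obtain a where "a \<in> A" "a \<noteq> {}" by auto
    then show ?thesis using A double_pseudocompl_nonempty[of a] by auto
  qed
  then show "?pp (\<Squnion>\<^bsub>L\<^esub> A) \<sqsubseteq>\<^bsub>L\<^esub> \<Squnion>\<^bsub>L\<^esub> (?pp ` A)"
    using A ppA by (simp add: sup_eq)
qed

end

section \<open>The particular point and cofinite topologies\<close>

lemma irreducible_particular_point: "irreducible_space {U :: 'b set. U = {} \<or> p \<in> U}"
  by unfold_locales auto

lemma irreducible_cofinite:
  assumes "infinite (UNIV :: 'b set)"
  shows "irreducible_space {U :: 'b set. U = {} \<or> finite (- U)}"
proof unfold_locales
  fix S :: "'b set set" assume S: "S \<subseteq> {U. U = {} \<or> finite (- U)}"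
  show "\<Union>S \<in> {U. U = {} \<or> finite (- U)}"
  proof (cases "\<Union>S = {}")
    case False
    then obtain U where U: "U \<in> S" "finite (- U)" using S by auto
    then have "finite (- \<Union>S)" by (elim rev_finite_subset) auto
    then show ?thesis by simp
  qed simp
next
  fix a b :: "'b set"
  assume "a \<in> {U. U = {} \<or> finite (- U)}" "b \<in> {U. U = {} \<or> finite (- U)}" "a \<noteq> {}" "b \<noteq> {}"
  then have "finite (- (a \<inter> b))" by simp
  then show "a \<inter> b \<noteq> {}" using assms by (metis Compl_empty_eq)
qed auto

text \<open>If \<open>{}\<close> belongs to the family, its pseudocomplement \<open>UNIV\<close>
  fills the right side. Otherwise \<open>{p}\<close> is a lower bound, so the infimum is nonempty
  and the left side is empty.\<close>

lemma IDM_particular_point: "IDM (inclusion_order {U :: 'b set. U = {} \<or> p \<in> U})"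
proof -
  interpret irreducible_space "{U :: 'b set. U = {} \<or> p \<in> U}"
    by (rule irreducible_particular_point)
  show ?thesis unfolding IDM_def
  proof (intro allI impI)
    fix A assume A: "A \<subseteq> carrier L"
    have pA: "pseudocompl L ` A \<subseteq> carrier L" using pseudocompl_closed by blast
    show "pseudocompl L (\<Sqinter>\<^bsub>L\<^esub> A) \<sqsubseteq>\<^bsub>L\<^esub> \<Squnion>\<^bsub>L\<^esub> (pseudocompl L ` A)"
    proof (cases "{} \<in> A")
      case True
      then have "UNIV \<in> pseudocompl L ` A" using pseudocompl_empty by force
      then have "UNIV \<subseteq> \<Squnion>\<^bsub>L\<^esub> (pseudocompl L ` A)" using lat.sup_upper[OF pA] by simp
      then show ?thesis by auto
    next
      case False
      have "{p} \<subseteq> \<Sqinter>\<^bsub>L\<^esub> A"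
        using lat.inf_greatest[OF A, of "{p}"] A False by auto
      then have "pseudocompl L (\<Sqinter>\<^bsub>L\<^esub> A) = {}"
        using lat.inf_closed[OF A] by (intro pseudocompl_nonempty) auto
      then show ?thesis by simp
    qed
  qed
qed

text \<open>Only \<open>{}\<close> is disjoint from the open set \<open>{p}\<close>, and joining it
  to \<open>{p}\<close> leaves \<open>q\<close> uncovered.\<close>

lemma not_boolean_particular_point:
  assumes "q \<noteq> p"
  shows "\<not> complete_boolean_algebra (inclusion_order {U :: 'b set. U = {} \<or> p \<in> U})"
proof
  interpret irreducible_space "{U :: 'b set. U = {} \<or> p \<in> U}"
    by (rule irreducible_particular_point)
  assume "complete_boolean_algebra L"
  then have "\<forall>a\<in>carrier L. \<exists>b\<in>carrier L. a \<sqinter>\<^bsub>L\<^esub> b = \<bottom>\<^bsub>L\<^esub> \<and> a \<squnion>\<^bsub>L\<^esub> b = \<top>\<^bsub>L\<^esub>"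
    unfolding complete_boolean_algebra_def by (elim conjE)
  from bspec[OF this, of "{p}"]
  obtain b where b: "b = {} \<or> p \<in> b" "{p} \<sqinter>\<^bsub>L\<^esub> b = \<bottom>\<^bsub>L\<^esub>" "{p} \<squnion>\<^bsub>L\<^esub> b = \<top>\<^bsub>L\<^esub>"
    by auto
  have "{p} \<inter> b = {}" using b(1,2) by (simp add: meet_eq bottom_eq)
  then have "b = {}" using b(1) by auto
  then have "{p} \<squnion>\<^bsub>L\<^esub> b = {p}" by (simp add: join_def sup_eq)
  moreover have "UNIV \<subseteq> \<top>\<^bsub>L\<^esub>" using lat.top_higher[of UNIV] by simp
  ultimately show False using b(3) assms by auto
qed

lemma not_IDM_cofinite:
  assumes "infinite (UNIV :: 'b set)"
  shows "\<not> IDM (inclusion_order {U :: 'b set. U = {} \<or> finite (- U)})"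
proof
  interpret irreducible_space "{U :: 'b set. U = {} \<or> finite (- U)}"
    by (rule irreducible_cofinite[OF assms])
  let ?A = "range (\<lambda>x :: 'b. - {x})"
  have A: "?A \<subseteq> carrier L" by auto
  have "\<Sqinter>\<^bsub>L\<^esub> ?A \<subseteq> - {x}" for x
    using lat.inf_lower[OF A, of "- {x}"] by simp
  then have "\<Sqinter>\<^bsub>L\<^esub> ?A = {}" by blast
  \<comment> \<open>Infinitely many points keep \<open>- {x}\<close> nonempty, so all these
    pseudocomplements are empty and IDM would give \<open>UNIV \<subseteq> {}\<close>.\<close>
  moreover have ne: "- {x} \<noteq> {}" for x :: 'b
    using assms by (metis finite.emptyI finite_insert Compl_empty_eq double_complement)
  then have "pseudocompl L (- {x}) = {}" for x :: 'b
    by (intro pseudocompl_nonempty) auto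
  then have "pseudocompl L ` ?A = {{}}" by (auto simp: image_image)
  moreover assume "IDM L"
  then have "pseudocompl L (\<Sqinter>\<^bsub>L\<^esub> ?A) \<subseteq> \<Squnion>\<^bsub>L\<^esub> (pseudocompl L ` ?A)"
    using A unfolding IDM_def by simp
  ultimately show False by (simp add: pseudocompl_empty sup_eq)
qed


section \<open>Ideals of a power set\<close>

definition set_ideals :: "'b set set set" where
  "set_ideals = {I. {} \<in> I \<and> (\<forall>A\<in>I. \<forall>B. B \<subseteq> A \<longrightarrow> B \<in> I) \<and> (\<forall>A\<in>I. \<forall>B\<in>I. A \<union> B \<in> I)}"

text \<open>The ideal generated by the union of \<open>S\<close>. For empty \<open>S\<close> only
  \<open>F = {}\<close> is available, which leaves the zero ideal.\<close>

definition ideal_join :: "'b set set set \<Rightarrow> 'b set set" where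
  "ideal_join S = {A. \<exists>F. finite F \<and> F \<subseteq> \<Union>S \<and> A \<subseteq> \<Union>F}"

lemma set_ideals_finite_Union:
  assumes "I \<in> set_ideals" "finite F" "F \<subseteq> I"
  shows "\<Union>F \<in> I"
  using assms(2,3,1) by (induction F rule: finite_induct) (auto simp: set_ideals_def)

text \<open>Downward closure puts singletons into the ideal; this reduces questions about the
  intersection of two ideals to points of their unions.\<close>

lemma singleton_mem_set_ideal_iff:
  assumes "I \<in> set_ideals"
  shows "{x} \<in> I \<longleftrightarrow> x \<in> \<Union>I"
proof
  assume "x \<in> \<Union>I"
  then obtain A where "A \<in> I" "{x} \<subseteq> A" by auto
  then show "{x} \<in> I" using assms by (simp add: set_ideals_def)
qed auto

lemma Pow_set_ideals: "Pow A \<in> set_ideals"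
  by (auto simp: set_ideals_def)

interpretation ideals: set_frame "set_ideals :: 'b set set set" ideal_join
proof unfold_locales
  fix S :: "'b set set set" and a b :: "'b set set"
  assume S: "S \<subseteq> set_ideals"
  show "ideal_join S \<in> set_ideals"
    unfolding set_ideals_def
  proof (intro CollectI conjI ballI allI impI)
    show "{} \<in> ideal_join S" by (auto simp: ideal_join_def)
    show "B \<in> ideal_join S" if "A \<in> ideal_join S" "B \<subseteq> A" for A B
      using that unfolding ideal_join_def by blast
    show "A \<union> B \<in> ideal_join S" if AB: "A \<in> ideal_join S" "B \<in> ideal_join S" for A B
    proof -
      obtain F G where "finite F" "F \<subseteq> \<Union>S" "A \<subseteq> \<Union>F" "finite G" "G \<subseteq> \<Union>S" "B \<subseteq> \<Union>G"
        using AB unfolding ideal_join_def by blast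
      then show ?thesis unfolding ideal_join_def by (auto intro!: exI[of _ "F \<union> G"])
    qed
  qed
  show "a \<subseteq> ideal_join S" if "a \<in> S"
  proof
    fix A assume "A \<in> a"
    then show "A \<in> ideal_join S"
      using that unfolding ideal_join_def by (auto intro!: exI[of _ "{A}"])
  qed
  show "ideal_join S \<subseteq> b" if b: "b \<in> set_ideals" and ub: "\<And>a. a \<in> S \<Longrightarrow> a \<subseteq> b"
  proof
    fix A assume "A \<in> ideal_join S"
    then obtain F where "finite F" "F \<subseteq> \<Union>S" "A \<subseteq> \<Union>F" unfolding ideal_join_def by blast
    moreover have "\<Union>F \<in> b"
      by (rule set_ideals_finite_Union[OF b \<open>finite F\<close>]) (use \<open>F \<subseteq> \<Union>S\<close> ub in blast)
    ultimately show "A \<in> b" using b unfolding set_ideals_def by blast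
  qed
  show "a \<inter> ideal_join S \<subseteq> ideal_join ((\<lambda>b. a \<inter> b) ` S)" if a: "a \<in> set_ideals"
  proof
    fix A assume "A \<in> a \<inter> ideal_join S"
    then obtain F where A: "A \<in> a" and F: "finite F" "F \<subseteq> \<Union>S" "A \<subseteq> \<Union>F"
      unfolding ideal_join_def by blast
    \<comment> \<open>The finite cover \<open>F\<close> of \<open>A\<close> is cut down to
      \<open>A\<close>: each piece lies in \<open>a\<close> as a subset of \<open>A\<close>, and in
      the ideal that contributes \<open>B\<close>.\<close>
    have "A \<inter> B \<in> \<Union>((\<lambda>b. a \<inter> b) ` S)" if B: "B \<in> F" for B
    proof -
      obtain b where b: "b \<in> S" "B \<in> b" using F B by blast
      then have "A \<inter> B \<in> b" using S unfolding set_ideals_def by blast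
      moreover have "A \<inter> B \<in> a" using a A unfolding set_ideals_def by blast
      ultimately show ?thesis using b by blast
    qed
    then show "A \<in> ideal_join ((\<lambda>b. a \<inter> b) ` S)"
      using F unfolding ideal_join_def by (auto intro!: exI[of _ "(\<lambda>B. A \<inter> B) ` F"])
  qed
next
  fix a b :: "'b set set"
  assume "a \<in> set_ideals" "b \<in> set_ideals"
  then show "a \<inter> b \<in> set_ideals" unfolding set_ideals_def by blast
qed

section \<open>Pseudocomplements in the frame of ideals\<close>

lemma ideal_join_empty: "ideal_join {} = {{}}"
  by (auto simp: ideal_join_def)

text \<open>Two ideals meet in the zero ideal exactly when their unions are disjoint, since a common
  point \<open>x\<close> would put \<open>{x}\<close> into both.\<close>

lemma pseudocompl_set_ideal:
  assumes I: "I \<in> set_ideals"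
  shows "pseudocompl (inclusion_order set_ideals) I = Pow (- \<Union>I)"
proof (rule ideals.pseudocompl_eqI[OF I Pow_set_ideals])
  fix C :: "'a set set" assume C: "C \<in> set_ideals"
  have mem: "{} \<in> C" "{} \<in> I" using C I unfolding set_ideals_def by auto
  show "C \<subseteq> Pow (- \<Union>I) \<longleftrightarrow> C \<inter> I = ideal_join {}"
  proof
    assume "C \<subseteq> Pow (- \<Union>I)"
    then show "C \<inter> I = ideal_join {}" using mem unfolding ideal_join_empty by blast
  next
    assume CI: "C \<inter> I = ideal_join {}"
    have "x \<notin> B" if "A \<in> C" "x \<in> A" "B \<in> I" for A B x
    proof
      assume "x \<in> B"
      then have "{x} \<in> C" "{x} \<in> I" using that C I by (auto simp: singleton_mem_set_ideal_iff)
      then show False using CI unfolding ideal_join_empty by blast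
    qed
    then show "C \<subseteq> Pow (- \<Union>I)" by blast
  qed
qed

text \<open>Under the formula for pseudocomplements the law reduces to two facts: the union of
  \<open>I \<inter> J\<close> is the intersection of the unions, and \<open>Pow\<close> turns a
  binary union into a join of ideals.\<close>

lemma extremally_disconnected_set_ideals:
  "extremally_disconnected (inclusion_order (set_ideals :: 'b set set set))"
  unfolding extremally_disconnected_def
proof (intro ballI)
  let ?L = "inclusion_order (set_ideals :: 'b set set set)"
  fix I J assume "I \<in> carrier ?L" "J \<in> carrier ?L"
  then have I: "I \<in> set_ideals" and J: "J \<in> set_ideals" by auto
  have un: "\<Union>(I \<inter> J) = \<Union>I \<inter> \<Union>J"
  proof
    show "\<Union>I \<inter> \<Union>J \<subseteq> \<Union>(I \<inter> J)"
    proof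
      fix x assume "x \<in> \<Union>I \<inter> \<Union>J"
      then have "{x} \<in> I" "{x} \<in> J" using I J by (simp_all add: singleton_mem_set_ideal_iff)
      then show "x \<in> \<Union>(I \<inter> J)" by blast
    qed
  qed auto
  have "Pow (X \<union> Y) = ideal_join {Pow X, Pow Y}" for X Y :: "'b set"
  proof
    show "Pow (X \<union> Y) \<subseteq> ideal_join {Pow X, Pow Y}"
      unfolding ideal_join_def by (auto intro!: exI[of _ "{X, Y}"])
    show "ideal_join {Pow X, Pow Y} \<subseteq> Pow (X \<union> Y)"
      by (rule ideals.J_least) (auto simp: Pow_set_ideals)
  qed
  then show "pseudocompl ?L (I \<sqinter>\<^bsub>?L\<^esub> J) = pseudocompl ?L I \<squnion>\<^bsub>?L\<^esub> pseudocompl ?L J"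
    using I J ideals.Int_closed[OF I J]
    by (simp add: ideals.meet_eq pseudocompl_set_ideal un join_def ideals.sup_eq Pow_set_ideals)
qed

lemma not_IED_set_ideals:
  assumes "infinite (UNIV :: 'b set)"
  shows "\<not> IED (inclusion_order (set_ideals :: 'b set set set))"
proof
  let ?L = "inclusion_order (set_ideals :: 'b set set set)"
  let ?A = "range (\<lambda>x :: 'b. Pow {x})"
  have A: "?A \<subseteq> set_ideals" using Pow_set_ideals by blast
  have pp: "pseudocompl ?L (pseudocompl ?L I) = Pow (\<Union>I)" if "I \<in> set_ideals" for I
    using that by (simp add: pseudocompl_set_ideal Pow_set_ideals)
  have JA: "ideal_join ?A \<in> set_ideals" by (rule ideals.J_closed[OF A])
  have "Pow {x} \<subseteq> ideal_join ?A" for x :: 'b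
    by (rule ideals.J_upper[OF A]) simp
  then have un: "\<Union>(ideal_join ?A) = UNIV" by blast
  \<comment> \<open>Every generator is a subset of a singleton, and only finitely many are used to
    cover \<open>B\<close>.\<close>
  have fin: "finite B" if B: "B \<in> ideal_join ?A" for B
  proof -
    obtain F where F: "finite F" "F \<subseteq> \<Union>?A" "B \<subseteq> \<Union>F"
      using B unfolding ideal_join_def by blast
    have "finite (\<Union>F)" using F(1) by (rule finite_Union) (use F(2) finite_subset in blast)
    then show ?thesis using F(3) finite_subset by blast
  qed
  \<comment> \<open>Each \<open>Pow {x}\<close> equals its double pseudocomplement, so the right
    side of IED is the join itself, while the left side is \<open>Pow UNIV\<close>.\<close>
  have img: "(\<lambda>a. pseudocompl ?L (pseudocompl ?L a)) ` ?A = ?A"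
    by (simp add: image_image pp Pow_set_ideals)
  assume "IED ?L"
  then have "pseudocompl ?L (pseudocompl ?L (\<Squnion>\<^bsub>?L\<^esub> ?A))
      \<subseteq> \<Squnion>\<^bsub>?L\<^esub> ((\<lambda>a. pseudocompl ?L (pseudocompl ?L a)) ` ?A)"
    using A unfolding IED_def by simp
  then have "UNIV \<in> ideal_join ?A"
    unfolding img using A JA by (simp add: ideals.sup_eq pp un) blast
  then show False using fin assms by blast
qed


theorem mainTheorem1:
  shows "(\<forall>L :: ('a, 'm) gorder_scheme. frame L \<longrightarrow>
            (complete_boolean_algebra L \<longrightarrow> IDM L) \<and>
            (IDM L \<longrightarrow> IED L) \<and>
            (IED L \<longrightarrow> extremally_disconnected L)) \<and>
         (\<exists>L :: nat set set gorder. frame L \<and> IDM L \<and> \<not> complete_boolean_algebra L) \<and>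
         (\<exists>L :: nat set set gorder. frame L \<and> IED L \<and> \<not> IDM L) \<and>
         (\<exists>L :: nat set set gorder. frame L \<and> extremally_disconnected L \<and> \<not> IED L)"
proof (intro conjI)
  show "\<forall>L :: ('a, 'm) gorder_scheme. frame L \<longrightarrow>
            (complete_boolean_algebra L \<longrightarrow> IDM L) \<and>
            (IDM L \<longrightarrow> IED L) \<and>
            (IED L \<longrightarrow> extremally_disconnected L)"
    using frame.complete_boolean_algebra_imp_IDM frame.IDM_imp_IED
      frame.IED_imp_extremally_disconnected by blast
next
  \<comment> \<open>Frame elements have type \<open>nat set set\<close>, so the points of the two
    topologies are sets of naturals: here \<open>{}\<close> is the particular point and
    \<open>{0}\<close> a second point. The third example takes ideals of sets of naturals.\<close>
  interpret irreducible_space "{U :: nat set set. U = {} \<or> {} \<in> U}"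
    by (rule irreducible_particular_point)
  have "\<not> complete_boolean_algebra L" by (rule not_boolean_particular_point[of "{0}"]) simp
  then show "\<exists>L :: nat set set gorder. frame L \<and> IDM L \<and> \<not> complete_boolean_algebra L"
    by (intro exI conjI) (rule frame_L, rule IDM_particular_point)
next
  have inf: "infinite (UNIV :: nat set set)"
    by (simp add: Finite_Set.finite_set)
  then interpret irreducible_space "{U :: nat set set. U = {} \<or> finite (- U)}"
    by (rule irreducible_cofinite)
  show "\<exists>L :: nat set set gorder. frame L \<and> IED L \<and> \<not> IDM L"
    by (intro exI conjI) (rule frame_L, rule IED_L, rule not_IDM_cofinite[OF inf])
next
  show "\<exists>L :: nat set set gorder. frame L \<and> extremally_disconnected L \<and> \<not> IED L"
    by (intro exI conjI) (rule ideals.frame_L, rule extremally_disconnected_set_ideals,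
        rule not_IED_set_ideals[OF infinite_UNIV_nat])
qed

end
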